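(* Let $p$ be a prime, $n,m\ge 1$ integers, and $F:\mathbb{F}_{p^n}\to\mathbb{F}_{p^m}$ any function. For every $u\in\mathbb{F}_{p^n}$, $$\sum_{v\in\mathbb{F}_{p^m}^*}\sum_{j\in\mathbb{F}_p}|L_F(u,v;j)|^2=\frac{p-1}{p}\left(p^mE_F(u)-p^{2n}\right)=(p-1)p^{m-1}\sum_{b\in\mathbb{F}_{p^m}}\left(\mathrm{DDT}_F(u,b)-p^{n-m}\right)^2.$$ More generally, if $\nu_k(u)=\#\{b\in\mathbb{F}_{p^m}:\mathrm{DDT}_F(u,b)=k\}$ denotes the differential spectrum of the $u$-th DDT row, then $$\sum_{v\in\mathbb{F}_{p^m}^*}\sum_{j\in\mathbb{F}_p}|L_F(u,v;j)|^2=(p-1)p^{m-1}\sum_{k\ge0}\nu_k(u)\left(k-p^{n-m}\right)^2.$$ Consequently, for every nonzero $u\in\mathbb{F}_{p^n}$, $$(\Gamma_F^{(p)})^2\ge\frac{p-1}{p^2(p^m-1)}\left(p^mE_F(u)-p^{2n}\right),$$ and hence the same bound holds with the right-hand side maximized over $u\ne0$.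
   Context: $\mathrm{Tr}_1^m$ is the absolute trace $\mathbb{F}_{p^m}\to\mathbb{F}_p$; a superscript $*$ denotes nonzero elements. The derivative is $D_uF(x)=F(x+u)-F(x)$. The differential distribution table is $\mathrm{DDT}_F(u,b)=\#\{x\in\mathbb{F}_{p^n}:D_uF(x)=b\}$, and the collision energy of its $u$-th row is $E_F(u)=\sum_{b\in\mathbb{F}_{p^m}}\mathrm{DDT}_F(u,b)^2$. The centered level count is $L_F(u,v;j)=\#\{x\in\mathbb{F}_{p^n}:\mathrm{Tr}_1^m(vD_uF(x))=j\}-p^{n-1}$. The full-profile uniformity is $\Gamma_F^{(p)}=\max_{u\in\mathbb{F}_{p^n}^*,\,v\in\mathbb{F}_{p^m}^*,\,j\in\mathbb{F}_p}|L_F(u,v;j)|$. The number $p^{n-m}$ is a rational number (possibly non-integer if $n<m$). *)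

theory Defs
  imports
    Complex_Main
    "HOL-Library.Cardinality"
    "HOL-Computational_Algebra.Primes"
begin

text \<open>
  Throughout, the field with \<open>p ^ n\<close> elements is a type \<open>'a :: finite_field\<close> with
  \<open>CARD('a) = p ^ n\<close>, and the field with \<open>p ^ m\<close> elements is a type \<open>'b :: finite_field\<close> with
  \<open>CARD('b) = p ^ m\<close>.  The prime field with \<open>p\<close> elements is identified with the prime subfield
  of \<open>'b\<close>; this is where the absolute trace of \<open>'b\<close> takes its values.
\<close>

text \<open>In characteristic \<open>p\<close> the image of the integers is already a field (with \<open>p\<close> elements).\<close>
definition prime_subfield :: "'b::finite_field set" where
  "prime_subfield = range of_int"

definition abs_trace :: "nat \<Rightarrow> nat \<Rightarrow> 'b::finite_field \<Rightarrow> 'b" where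
  "abs_trace p m y = (\<Sum>i<m. y ^ (p ^ i))"

definition deriv_dir :: "('a::finite_field \<Rightarrow> 'b::finite_field) \<Rightarrow> 'a \<Rightarrow> 'a \<Rightarrow> 'b" where
  "deriv_dir F u x = F (x + u) - F x"

definition DDT :: "('a::finite_field \<Rightarrow> 'b::finite_field) \<Rightarrow> 'a \<Rightarrow> 'b \<Rightarrow> nat" where
  "DDT F u b = card {x. deriv_dir F u x = b}"

definition collision_energy :: "('a::finite_field \<Rightarrow> 'b::finite_field) \<Rightarrow> 'a \<Rightarrow> nat" where
  "collision_energy F u = (\<Sum>b\<in>UNIV. (DDT F u b)\<^sup>2)"

definition diff_spectrum :: "('a::finite_field \<Rightarrow> 'b::finite_field) \<Rightarrow> 'a \<Rightarrow> nat \<Rightarrow> nat" where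
  "diff_spectrum F u k = card {b. DDT F u b = k}"

text \<open>Integer-valued; the exponent \<open>n - 1\<close> is on naturals and is only meant for \<open>n \<ge> 1\<close>.\<close>
definition centered_level_count ::
  "nat \<Rightarrow> nat \<Rightarrow> nat \<Rightarrow> ('a::finite_field \<Rightarrow> 'b::finite_field) \<Rightarrow> 'a \<Rightarrow> 'b \<Rightarrow> 'b \<Rightarrow> int" where
  "centered_level_count p n m F u v j =
     int (card {x. abs_trace p m (v * deriv_dir F u x) = j}) - int (p ^ (n - 1))"

definition full_profile_uniformity ::
  "nat \<Rightarrow> nat \<Rightarrow> nat \<Rightarrow> ('a::finite_field \<Rightarrow> 'b::finite_field) \<Rightarrow> int" where
  "full_profile_uniformity p n m F =
     Max {\<bar>centered_level_count p n m F u v j\<bar> | u v j. u \<noteq> 0 \<and> v \<noteq> 0 \<and> j \<in> prime_subfield}"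

end

theory Submission
  imports Defs "HOL-Computational_Algebra.Polynomial" "HOL-Number_Theory.Residues"
begin

text \<open>
  The number of pairs \<open>(x, y)\<close> with \<open>Tr (v * (D x - D y)) = 0\<close>, where \<open>D\<close> is the derivative of
  \<open>F\<close> in direction \<open>u\<close>, is counted in two ways.  For fixed \<open>v\<close> it is the sum over \<open>j\<close> of the squared
  level counts.  For a fixed pair, the number of such \<open>v\<close> is \<open>p ^ m\<close> if \<open>D x = D y\<close> and
  \<open>p ^ (m - 1)\<close> otherwise, because all fibres of the trace over the prime field have the same size;
  so no characters are needed.  The bound on the uniformity is the comparison of
  the maximum with the mean of the \<open>p * (p ^ m - 1)\<close> squares.
\<close>

section \<open>Fibres of the absolute trace\<close>

lemma CHAR_eq_if_CARD_eq_prime_power: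
  assumes "prime p" "CARD('b::finite_field) = p ^ m"
  shows "CHAR('b) = p"
proof -
  have "CHAR('b) dvd p ^ m"
    using CHAR_dvd_CARD[where 'a = 'b] assms(2) by simp
  then have "CHAR('b) dvd p"
    using CHAR_prime prime_dvd_power_nat by blast
  then show ?thesis
    using assms(1) CHAR_prime primes_dvd_imp_eq by blast
qed

lemma prime_subfield_eq_of_nat_image:
  "(prime_subfield :: 'b::finite_field set) = of_nat ` {..<CHAR('b)}"
proof
  show "(prime_subfield :: 'b set) \<subseteq> of_nat ` {..<CHAR('b)}"
  proof
    fix y :: 'b assume "y \<in> prime_subfield"
    then obtain k where k: "y = of_int k" by (auto simp: prime_subfield_def)
    define r where "r = nat (k mod int CHAR('b))"
    have r: "int r = k mod int CHAR('b)" by (simp add: r_def)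
    then have "int r < int CHAR('b)" by simp
    moreover have "int CHAR('b) dvd k - int r"
      unfolding r by (simp add: minus_mod_eq_mult_div)
    then have "of_int (k - int r) = (0::'b)"
      by (simp only: of_int_eq_0_iff_char_dvd)
    then have "y = of_nat r" by (simp add: k)
    ultimately show "y \<in> of_nat ` {..<CHAR('b)}" by auto
  qed
  have "of_nat i \<in> range (of_int :: int \<Rightarrow> 'b)" for i
    by (metis of_int_of_nat_eq rangeI)
  then show "of_nat ` {..<CHAR('b)} \<subseteq> (prime_subfield :: 'b set)"
    by (auto simp: prime_subfield_def)
qed

lemma card_prime_subfield: "card (prime_subfield :: 'b::finite_field set) = CHAR('b)"
proof -
  have "inj_on (of_nat :: nat \<Rightarrow> 'b) {..<CHAR('b)}"
  proof (rule linorder_inj_onI)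
    fix i j assume ij: "i < j" "j \<in> {..<CHAR('b)}"
    then have "\<not> CHAR('b) dvd j - i" by (auto dest: dvd_imp_le)
    then show "of_nat i \<noteq> (of_nat j :: 'b)"
      using ij(1) by (simp add: of_nat_eq_iff_char_dvd)
  qed auto
  then show ?thesis by (simp only: prime_subfield_eq_of_nat_image card_image card_lessThan)
qed

lemma prime_subfield_power_CHAR:
  assumes "(y :: 'b::finite_field) \<in> prime_subfield"
  shows "y ^ CHAR('b) = y"
proof -
  obtain r where "y = of_nat r"
    using assms by (auto simp: prime_subfield_eq_of_nat_image)
  \<comment> \<open>Frobenius is additive and fixes 1, so it fixes every sum of ones.\<close>
  then have y: "y = (\<Sum>i<r. 1)" by simp
  show ?thesis
    unfolding y by (subst freshmans_dream_sum) auto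
qed

text \<open>The fixed points of Frobenius are the roots of \<open>X ^ CHAR('b) - X\<close>, hence at
  most \<open>CHAR('b)\<close> many, and the prime subfield already supplies that number of
  them.\<close>

lemma prime_subfield_eq_Frobenius_fixed:
  "(prime_subfield :: 'b::finite_field set) = {y. y ^ CHAR('b) = y}"
proof (rule card_subset_eq)
  have p: "CHAR('b) > 1" using CHAR_prime prime_gt_1_nat by blast
  define q :: "'b poly" where "q = Polynomial.monom 1 CHAR('b) - Polynomial.monom 1 1"
  have deg: "Polynomial.degree q \<le> CHAR('b)"
    unfolding q_def using p by (intro degree_diff_le) (auto simp: degree_monom_eq)
  \<comment> \<open>The two monomials have different degrees because the characteristic exceeds 1,
    so they cannot cancel.\<close>
  have "Polynomial.coeff q CHAR('b) = 1" using p by (simp add: q_def)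
  then have "q \<noteq> 0" by auto
  then have "card {y. poly q y = 0} \<le> CHAR('b)"
    using card_poly_roots_bound[of q] deg by linarith
  moreover have "{y. poly q y = 0} = {y. y ^ CHAR('b) = y}"
    by (simp add: q_def poly_monom)
  moreover show sub: "(prime_subfield :: 'b set) \<subseteq> {y. y ^ CHAR('b) = y}"
    using prime_subfield_power_CHAR by blast
  then have "card (prime_subfield :: 'b set) \<le> card {y::'b. y ^ CHAR('b) = y}"
    by (intro card_mono) auto
  ultimately show "card (prime_subfield :: 'b set) = card {y::'b. y ^ CHAR('b) = y}"
    by (simp add: card_prime_subfield)
qed auto

section \<open>Additivity, values and fibre sizes of the trace\<close>

context
  fixes p m :: nat
  assumes prime_p: "prime p" and m_pos: "m \<ge> 1" and CARD_b: "CARD('b::finite_field) = p ^ m"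
begin

lemma CHAR_b: "CHAR('b) = p"
  using CHAR_eq_if_CARD_eq_prime_power[OF prime_p CARD_b] .

lemma abs_trace_add: "abs_trace p m (x + y :: 'b) = abs_trace p m x + abs_trace p m y"
  unfolding abs_trace_def
  by (subst freshmans_dream'[OF _ refl, where ?'a = 'b, unfolded CHAR_b])
     (auto simp: prime_p sum.distrib)

lemma abs_trace_zero: "abs_trace p m (0::'b) = 0"
  using abs_trace_add[of 0 0] by (metis add.right_neutral add_left_cancel)

lemma abs_trace_diff: "abs_trace p m (x - y :: 'b) = abs_trace p m x - abs_trace p m y"
  using abs_trace_add[of "x - y" y] by (simp add: algebra_simps)

text \<open>Since \<open>y ^ p ^ m = y\<close>, raising to the power \<open>p\<close> permutes the
  summands of the trace cyclically; the trace is therefore fixed by Frobenius.\<close>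

lemma abs_trace_in_prime_subfield: "abs_trace p m (y::'b) \<in> prime_subfield"
proof -
  have "abs_trace p m y ^ p = (\<Sum>i<m. (y ^ p ^ i) ^ p)"
    unfolding abs_trace_def
    by (rule freshmans_dream_sum) (auto simp: CHAR_b prime_p)
  also have "\<dots> = (\<Sum>i<m. y ^ p ^ Suc i)"
    by (simp add: mult.commute flip: power_mult)
  also have "\<dots> = (\<Sum>i<m. y ^ p ^ i)"
  proof -
    have "y ^ p ^ m = y"
      using finite_field_power_card_eq_same[of y] CARD_b by simp
    then have "(\<Sum>i<Suc m. y ^ p ^ i) = (\<Sum>i<m. y ^ p ^ i) + y" by simp
    moreover have "(\<Sum>i<Suc m. y ^ p ^ i) = y + (\<Sum>i<m. y ^ p ^ Suc i)"
      by (subst sum.lessThan_Suc_shift) simp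
    ultimately show ?thesis by (metis add.commute add_left_cancel)
  qed
  finally show ?thesis
    by (simp add: prime_subfield_eq_Frobenius_fixed CHAR_b abs_trace_def)
qed

text \<open>A fibre is the root set of a nonzero polynomial of degree at most
  \<open>p ^ (m - 1)\<close>.\<close>

lemma card_abs_trace_fibre_le: "card {y::'b. abs_trace p m y = j} \<le> p ^ (m - 1)"
proof -
  define q where "q = (\<Sum>i<m. Polynomial.monom 1 (p ^ i)) - [:j:]"
  have p: "p > 1" using prime_p prime_gt_1_nat by blast
  have "Polynomial.degree q \<le> p ^ (m - 1)"
    unfolding q_def
  proof (intro degree_diff_le degree_sum_le)
    fix i assume "i \<in> {..<m}"
    then have "p ^ i \<le> p ^ (m - 1)" using p by (intro power_increasing) auto
    then show "Polynomial.degree (Polynomial.monom (1::'b) (p ^ i)) \<le> p ^ (m - 1)"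
      by (meson degree_monom_le order_trans)
  qed auto
  \<comment> \<open>The linear coefficient shows that \<open>q\<close> is nonzero: only
    \<open>i = 0\<close> contributes to it, and the constant \<open>j\<close> does not.\<close>
  moreover have "Polynomial.coeff q 1 = 1"
  proof -
    have "p ^ i = Suc 0 \<longleftrightarrow> i = 0" for i using p by (simp add: power_eq_if)
    then show ?thesis using m_pos by (simp add: q_def coeff_sum)
  qed
  then have "q \<noteq> 0" by auto
  then have "card {y. poly q y = 0} \<le> Polynomial.degree q" by (rule card_poly_roots_bound)
  moreover have "{y. poly q y = 0} = {y. abs_trace p m y = j}"
    by (simp add: q_def abs_trace_def poly_sum poly_monom)
  ultimately show ?thesis by simp
qed

text \<open>The \<open>p\<close> fibres cover \<open>p ^ m\<close> points and each has at most \<open>p ^ (m - 1)\<close>, the degree of the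
  trace polynomial; so all these bounds are attained.\<close>
lemma card_abs_trace_fibre:
  assumes "j \<in> prime_subfield"
  shows "card {y::'b. abs_trace p m y = j} = p ^ (m - 1)"
proof (rule ccontr)
  assume "card {y::'b. abs_trace p m y = j} \<noteq> p ^ (m - 1)"
  then have "card {y::'b. abs_trace p m y = j} < p ^ (m - 1)"
    using card_abs_trace_fibre_le[of j] by simp
  then have "(\<Sum>j\<in>prime_subfield. card {y::'b. abs_trace p m y = j})
      < (\<Sum>j\<in>(prime_subfield::'b set). p ^ (m - 1))"
    using assms card_abs_trace_fibre_le by (intro sum_strict_mono_ex1) auto
  also have "\<dots> = p ^ m"
    using m_pos by (simp add: card_prime_subfield CHAR_b power_eq_if)
  also have "(\<Sum>j\<in>prime_subfield. card {y::'b. abs_trace p m y = j})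
      = card (\<Union>j\<in>prime_subfield. {y::'b. abs_trace p m y = j})"
    by (subst card_UN_disjoint) auto
  also have "(\<Union>j\<in>prime_subfield. {y::'b. abs_trace p m y = j}) = UNIV"
    using abs_trace_in_prime_subfield by auto
  finally show False using CARD_b by simp
qed

text \<open>Multiplication by \<open>c\<close> maps this set bijectively onto the kernel of the
  trace.\<close>

lemma card_abs_trace_scaled_kernel:
  assumes "c \<noteq> (0::'b)"
  shows "card {v. abs_trace p m (v * c) = 0} = p ^ (m - 1)"
proof -
  have "bij_betw (\<lambda>v. v * c) {v. abs_trace p m (v * c) = 0} {y. abs_trace p m y = 0}"
    by (rule bij_betwI[where g = "\<lambda>y. y / c"]) (use assms in auto)
  then have "card {v. abs_trace p m (v * c) = 0} = card {y::'b. abs_trace p m y = 0}"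
    by (rule bij_betw_same_card)
  moreover have "(0::'b) \<in> prime_subfield"
    by (metis prime_subfield_def of_int_0 rangeI)
  ultimately show ?thesis by (simp add: card_abs_trace_fibre)
qed

end

section \<open>Counting collisions\<close>

lemma sum_card_fibres:
  fixes g :: "'a::finite \<Rightarrow> 'c"
  assumes "finite J" "range g \<subseteq> J"
  shows "(\<Sum>j\<in>J. card {x. g x = j}) = CARD('a)"
proof -
  have "(\<Sum>j\<in>J. card {x. g x = j}) = card (\<Union>j\<in>J. {x. g x = j})"
    using assms(1) by (subst card_UN_disjoint) auto
  also have "(\<Union>j\<in>J. {x. g x = j}) = UNIV" using assms(2) by auto
  finally show ?thesis .
qed

text \<open>The square of a fibre size counts the pairs inside that fibre, and the fibres over
  \<open>J\<close> cover the whole domain.\<close>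

lemma sum_card_fibres_squared:
  fixes g :: "'a::finite \<Rightarrow> 'c"
  assumes "finite J" "range g \<subseteq> J"
  shows "(\<Sum>j\<in>J. (card {x. g x = j})\<^sup>2) = card {z. g (fst z) = g (snd z)}"
proof -
  have "(\<Sum>j\<in>J. (card {x. g x = j})\<^sup>2) = (\<Sum>j\<in>J. card ({x. g x = j} \<times> {x. g x = j}))"
    by (simp add: card_cartesian_product power2_eq_square)
  also have "\<dots> = card (\<Union>j\<in>J. {x. g x = j} \<times> {x. g x = j})"
    using assms(1) by (subst card_UN_disjoint) auto
  also have "(\<Union>j\<in>J. {x. g x = j} \<times> {x. g x = j}) = {z. g (fst z) = g (snd z)}"
    using range_subsetD[OF assms(2)] by auto
  finally show ?thesis .
qed

text \<open>Regroups a sum over \<open>b\<close> by the value of \<open>f\<close>. The form with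
  \<open>sums\<close> serves the spectrum, which is summed over all naturals although only finitely
  many terms are nonzero.\<close>

lemma sum_fibre_counts:
  fixes f :: "'b::finite \<Rightarrow> nat" and h :: "nat \<Rightarrow> real"
  shows "(\<lambda>k. real (card {b. f b = k}) * h k) sums (\<Sum>b\<in>UNIV. h (f b))"
proof -
  have "(\<lambda>k. real (card {b. f b = k}) * h k) sums (\<Sum>k\<in>range f. real (card {b. f b = k}) * h k)"
  proof (rule sums_finite)
    fix k assume "k \<notin> range f"
    then have "{b. f b = k} = {}" by auto
    then show "real (card {b. f b = k}) * h k = 0" by simp
  qed simp
  also have "(\<Sum>k\<in>range f. real (card {b. f b = k}) * h k)
      = (\<Sum>k\<in>range f. \<Sum>b\<in>{b\<in>UNIV. f b = k}. h (f b))"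
    by (rule sum.cong) auto
  also have "\<dots> = (\<Sum>b\<in>UNIV. h (f b))"
    by (rule sum.group) auto
  finally show ?thesis .
qed

lemma sum_DDT: "(\<Sum>b\<in>UNIV. DDT (F :: 'a::finite_field \<Rightarrow> 'b::finite_field) u b) = CARD('a)"
  unfolding DDT_def by (rule sum_card_fibres) auto

lemma collision_energy_eq_card:
  "collision_energy F u = card {z. deriv_dir F u (fst z) = deriv_dir F u (snd z)}"
  unfolding collision_energy_def DDT_def by (rule sum_card_fibres_squared) auto

lemma sum_centered_square:
  fixes w :: "'c \<Rightarrow> real"
  shows "(\<Sum>j\<in>J. (w j - c)\<^sup>2) = (\<Sum>j\<in>J. (w j)\<^sup>2) - 2 * c * (\<Sum>j\<in>J. w j) + real (card J) * c\<^sup>2"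
  by (simp add: power2_diff sum.distrib sum_subtractf mult_ac flip: sum_distrib_left sum_distrib_right)

section \<open>Second moments of the level counts and of a DDT row\<close>

context
  fixes p n m :: nat and F :: "'a::finite_field \<Rightarrow> 'b::finite_field"
  assumes prime_p: "prime p" and n_pos: "n \<ge> 1" and m_pos: "m \<ge> 1"
    and CARD_a: "CARD('a) = p ^ n" and CARD_b: "CARD('b) = p ^ m"
begin

text \<open>Natural-valued and not centered, so that sums of squares are cardinalities; the mean is
  subtracted later, over the reals.\<close>

definition level :: "'a \<Rightarrow> 'b \<Rightarrow> 'b \<Rightarrow> nat" where
  "level u v j = card {x. abs_trace p m (v * deriv_dir F u x) = j}"

lemma sum_level_squared:
  "(\<Sum>j\<in>prime_subfield. (level u v j)\<^sup>2)
     = card {z. abs_trace p m (v * (deriv_dir F u (fst z) - deriv_dir F u (snd z))) = 0}"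
  unfolding level_def
  by (subst sum_card_fibres_squared)
     (auto simp: abs_trace_in_prime_subfield[OF prime_p m_pos CARD_b] right_diff_distrib
        abs_trace_diff[OF prime_p m_pos CARD_b])

lemma sum_level: "(\<Sum>j\<in>prime_subfield. level u v j) = p ^ n"
  unfolding level_def CARD_a[symmetric]
  by (rule sum_card_fibres) (auto simp: abs_trace_in_prime_subfield[OF prime_p m_pos CARD_b])

text \<open>The subtraction is one of naturals; \<open>collision_energy_le\<close> shows that it is
  not truncated.\<close>

lemma sum_level_squared_all:
  "(\<Sum>v\<in>UNIV. \<Sum>j\<in>prime_subfield. (level u v j)\<^sup>2)
     = p ^ m * collision_energy F u + p ^ (m - 1) * (p ^ (2 * n) - collision_energy F u)"
proof -
  define d where "d z = deriv_dir F u (fst z) - deriv_dir F u (snd z)" for z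
  have E: "collision_energy F u = card {z. d z = 0}"
    by (simp add: collision_energy_eq_card d_def)
  have "(\<Sum>v\<in>UNIV. \<Sum>j\<in>prime_subfield. (level u v j)\<^sup>2)
      = (\<Sum>v\<in>UNIV. card {z\<in>UNIV. abs_trace p m (v * d z) = 0})"
    by (simp add: sum_level_squared d_def)
  also have "\<dots> = (\<Sum>z\<in>UNIV. card {v\<in>UNIV. abs_trace p m (v * d z) = 0})"
    \<comment> \<open>Both sides become double sums of the same indicator, so the order of summation
      can be exchanged.\<close>
    unfolding card_eq_sum sum.inter_filter[OF finite] by (rule sum.swap)
  also have "\<dots> = (\<Sum>z\<in>UNIV. if d z = 0 then p ^ m else p ^ (m - 1))"
  proof (rule sum.cong)
    fix z
    show "card {v\<in>UNIV. abs_trace p m (v * d z) = 0} = (if d z = 0 then p ^ m else p ^ (m - 1))"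
      using card_abs_trace_scaled_kernel[OF prime_p m_pos CARD_b, of "d z"]
      by (simp add: abs_trace_zero[OF prime_p m_pos CARD_b] CARD_b)
  qed simp
  also have "\<dots> = p ^ m * card {z. d z = 0} + p ^ (m - 1) * card (- {z. d z = 0})"
    by (subst sum.If_cases) (auto simp: Collect_neg_eq)
  also have "card (- {z. d z = 0}) = p ^ (2 * n) - card {z. d z = 0}"
    by (simp add: Compl_eq_Diff_UNIV card_Diff_subset CARD_a mult_2 power_add)
  finally show ?thesis by (simp add: E)
qed

lemma collision_energy_le: "collision_energy F u \<le> p ^ (2 * n)"
proof -
  have "collision_energy F u \<le> CARD('a \<times> 'a)"
    unfolding collision_energy_eq_card by (rule card_mono) auto
  then show ?thesis by (simp add: CARD_a mult_2 power_add)
qed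

text \<open>For \<open>v = 0\<close> every pair qualifies. This is the term to remove from the sum
  over all \<open>v\<close>.\<close>

lemma sum_level_zero: "(\<Sum>j\<in>prime_subfield. (level u 0 j)\<^sup>2) = p ^ (2 * n)"
  by (simp add: sum_level_squared abs_trace_zero[OF prime_p m_pos CARD_b] CARD_a mult_2 power_add)

lemma sum_centered_level_count_squared:
  "(\<Sum>v\<in>UNIV - {0}. \<Sum>j\<in>prime_subfield. (real_of_int \<bar>centered_level_count p n m F u v j\<bar>)\<^sup>2)
     = (real p - 1) / real p * (real p ^ m * real (collision_energy F u) - real p ^ (2 * n))"
proof -
  have p: "real p > 0" using prime_p prime_gt_0_nat by auto
  have pm: "real p ^ m = real p * real p ^ (m - 1)" using m_pos by (simp add: power_eq_if)
  have pn: "real p ^ n = real p * real p ^ (n - 1)" using n_pos by (simp add: power_eq_if)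
  have p2n: "real p ^ (2 * n) = (real p ^ n)\<^sup>2" by (simp add: power_mult mult.commute flip: power_mult)
  have inner: "(\<Sum>j\<in>prime_subfield. (real_of_int \<bar>centered_level_count p n m F u v j\<bar>)\<^sup>2)
      = real (\<Sum>j\<in>prime_subfield. (level u v j)\<^sup>2) - real p ^ (2 * n) / real p" for v
  proof -
    have "(\<Sum>j\<in>prime_subfield. (real_of_int \<bar>centered_level_count p n m F u v j\<bar>)\<^sup>2)
        = (\<Sum>j\<in>prime_subfield. (real (level u v j) - real p ^ (n - 1))\<^sup>2)"
      by (simp add: centered_level_count_def level_def)
    also have "\<dots> = real (\<Sum>j\<in>prime_subfield. (level u v j)\<^sup>2)
        - 2 * real p ^ (n - 1) * real (\<Sum>j\<in>prime_subfield. level u v j)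
        + real p * (real p ^ (n - 1))\<^sup>2"
      by (simp add: sum_centered_square card_prime_subfield CHAR_b[OF prime_p m_pos CARD_b])
    \<comment> \<open>The cross term is \<open>-2 * p ^ (2 * n - 1)\<close> and the constant term is
      \<open>p ^ (2 * n - 1)\<close>.\<close>
    also have "\<dots> = real (\<Sum>j\<in>prime_subfield. (level u v j)\<^sup>2) - real p ^ (2 * n) / real p"
      unfolding sum_level p2n of_nat_power pn using p by (simp add: field_simps power2_eq_square)
    finally show ?thesis .
  qed
  have "(\<Sum>v\<in>UNIV - {0}. \<Sum>j\<in>prime_subfield. (real_of_int \<bar>centered_level_count p n m F u v j\<bar>)\<^sup>2)
      = (\<Sum>v\<in>UNIV. real (\<Sum>j\<in>prime_subfield. (level u v j)\<^sup>2) - real p ^ (2 * n) / real p)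
        - (real (\<Sum>j\<in>prime_subfield. (level u 0 j)\<^sup>2) - real p ^ (2 * n) / real p)"
    unfolding inner by (subst sum_diff) auto
  also have "\<dots> = real (\<Sum>v\<in>UNIV. \<Sum>j\<in>prime_subfield. (level u v j)\<^sup>2)
      - real p ^ m * (real p ^ (2 * n) / real p)
      - (real p ^ (2 * n) - real p ^ (2 * n) / real p)"
    unfolding sum_level_zero by (simp add: sum_subtractf CARD_b)
  \<comment> \<open>The term \<open>p ^ (m - 1) * p ^ (2 * n)\<close> from the double count cancels
    against the centering term summed over all \<open>v\<close>.\<close>
  also have "\<dots> = (real p - 1) / real p * (real p ^ m * real (collision_energy F u) - real p ^ (2 * n))"
    unfolding sum_level_squared_all
    using collision_energy_le[of u] p by (simp add: of_nat_diff pm field_simps)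
  finally show ?thesis .
qed

text \<open>The row entries sum to \<open>p ^ n\<close> over \<open>p ^ m\<close> values of
  \<open>b\<close>, so the centre is their mean and the sum of squared deviations is the energy
  minus \<open>(p ^ n)\<^sup>2 / p ^ m\<close>.\<close>

lemma energy_eq_variance:
  "(real p - 1) / real p * (real p ^ m * real (collision_energy F u) - real p ^ (2 * n))
     = (real p - 1) * real p ^ (m - 1)
         * (\<Sum>b\<in>UNIV. (real (DDT F u b) - real p powi (int n - int m))\<^sup>2)"
proof -
  have p: "real p > 0" using prime_p prime_gt_0_nat by auto
  have pm: "real p ^ m = real p * real p ^ (m - 1)" using m_pos by (simp add: power_eq_if)
  have p2n: "real p ^ (2 * n) = (real p ^ n)\<^sup>2" by (simp add: power_mult mult.commute flip: power_mult)
  have c: "real p powi (int n - int m) = real p ^ n / real p ^ m"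
    using p by (simp add: power_int_diff)
  have "(\<Sum>b\<in>UNIV. real (DDT F u b)) = real p ^ n"
    using sum_DDT[of F u] by (simp add: CARD_a flip: of_nat_sum)
  moreover have "(\<Sum>b\<in>UNIV. (real (DDT F u b))\<^sup>2) = real (collision_energy F u)"
    by (simp add: collision_energy_def)
  ultimately have variance: "(\<Sum>b\<in>UNIV. (real (DDT F u b) - real p powi (int n - int m))\<^sup>2)
      = real (collision_energy F u) - (real p ^ n)\<^sup>2 / real p ^ m"
    unfolding sum_centered_square c CARD_b of_nat_power
    using p by (simp add: field_simps power2_eq_square)
  show ?thesis
    unfolding variance p2n pm using p by (simp add: field_simps)
qed

section \<open>Lower bound for the uniformity\<close>

lemma abs_centered_level_count_le_full_profile_uniformity:
  assumes "u \<noteq> 0" "v \<noteq> 0" "j \<in> prime_subfield"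
  shows "\<bar>centered_level_count p n m F u v j\<bar> \<le> full_profile_uniformity p n m F"
  unfolding full_profile_uniformity_def
proof (rule Max_ge)
  \<comment> \<open>\<open>Max_ge\<close> needs finiteness, which holds because the values lie in
    the image of a finite type.\<close>
  have "{\<bar>centered_level_count p n m F u v j\<bar> | u v j. u \<noteq> 0 \<and> v \<noteq> 0 \<and> j \<in> prime_subfield}
      \<subseteq> (\<lambda>(u, v, j). \<bar>centered_level_count p n m F u v j\<bar>) ` UNIV"
    by (fastforce simp: image_iff)
  then show "finite {\<bar>centered_level_count p n m F u v j\<bar> | u v j.
      u \<noteq> 0 \<and> v \<noteq> 0 \<and> j \<in> prime_subfield}"
    by (rule finite_subset) simp
qed (use assms in blast)

lemma full_profile_uniformity_ge:
  assumes "u \<noteq> 0"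
  shows "(real p - 1) / ((real p)\<^sup>2 * (real p ^ m - 1))
      * (real p ^ m * real (collision_energy F u) - real p ^ (2 * n))
    \<le> (real_of_int (full_profile_uniformity p n m F))\<^sup>2"
proof -
  let ?G = "(real_of_int (full_profile_uniformity p n m F))\<^sup>2"
  let ?X = "real p ^ m * real (collision_energy F u) - real p ^ (2 * n)"
  have p: "real p > 1" using prime_p prime_gt_1_nat by auto
  then have pm: "real p ^ m > 1" using m_pos by (intro one_less_power) auto
  have "(\<Sum>v\<in>UNIV - {0}. \<Sum>j\<in>prime_subfield.
        (real_of_int \<bar>centered_level_count p n m F u v j\<bar>)\<^sup>2)
      \<le> (\<Sum>v\<in>UNIV - {0::'b}. \<Sum>j\<in>(prime_subfield::'b set). ?G)"
    using assms
    by (intro sum_mono power_mono)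
       \<comment> \<open>With \<open>of_int_abs\<close> removed, the absolute value stays inside the
         cast and the integer bound applies.\<close>
       (auto simp: abs_centered_level_count_le_full_profile_uniformity simp del: of_int_abs)
  also have "\<dots> = (real p ^ m - 1) * (real p * ?G)"
    using pm by (simp add: card_prime_subfield CHAR_b[OF prime_p m_pos CARD_b] card_Diff_singleton
        CARD_b of_nat_diff Suc_leI prime_p prime_gt_0_nat)
  finally have "(real p - 1) / real p * ?X \<le> (real p ^ m - 1) * (real p * ?G)"
    unfolding sum_centered_level_count_squared .
  moreover have "(real p - 1) / ((real p)\<^sup>2 * (real p ^ m - 1)) * ?X
      = ((real p - 1) / real p * ?X) / ((real p ^ m - 1) * real p)"
    by (simp add: power2_eq_square)
  ultimately show ?thesis
    using p pm by (simp add: pos_divide_le_eq mult_ac power2_eq_square)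
qed

end

theorem theorem4p4:
  fixes p n m :: nat
    and F :: "'a::finite_field \<Rightarrow> 'b::finite_field"
  assumes "prime p" and "n \<ge> 1" and "m \<ge> 1"
    and "CARD('a) = p ^ n" and "CARD('b) = p ^ m"
  shows
    "(\<forall>u.
        (\<Sum>v\<in>UNIV - {0}. \<Sum>j\<in>prime_subfield. (real_of_int \<bar>centered_level_count p n m F u v j\<bar>)\<^sup>2)
          = (real p - 1) / real p * (real p ^ m * real (collision_energy F u) - real p ^ (2 * n))
      \<and> (real p - 1) / real p * (real p ^ m * real (collision_energy F u) - real p ^ (2 * n))
          = (real p - 1) * real p ^ (m - 1)
              * (\<Sum>b\<in>UNIV. (real (DDT F u b) - real p powi (int n - int m))\<^sup>2))
   \<and> (\<forall>u.
        summable (\<lambda>k. real (diff_spectrum F u k) * (real k - real p powi (int n - int m))\<^sup>2)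
      \<and> (\<Sum>v\<in>UNIV - {0}. \<Sum>j\<in>prime_subfield. (real_of_int \<bar>centered_level_count p n m F u v j\<bar>)\<^sup>2)
          = (real p - 1) * real p ^ (m - 1)
              * (\<Sum>k. real (diff_spectrum F u k) * (real k - real p powi (int n - int m))\<^sup>2))
   \<and> (\<forall>u. u \<noteq> 0 \<longrightarrow>
        (real_of_int (full_profile_uniformity p n m F))\<^sup>2
          \<ge> (real p - 1) / ((real p)\<^sup>2 * (real p ^ m - 1))
              * (real p ^ m * real (collision_energy F u) - real p ^ (2 * n)))
   \<and> (real_of_int (full_profile_uniformity p n m F))\<^sup>2
        \<ge> Max ((\<lambda>u. (real p - 1) / ((real p)\<^sup>2 * (real p ^ m - 1))
              * (real p ^ m * real (collision_energy F u) - real p ^ (2 * n))) ` (UNIV - {0}))"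
proof (intro conjI allI impI)
  note sum_sq = sum_centered_level_count_squared[OF assms]
  note variance = energy_eq_variance[OF assms]
  note bound = full_profile_uniformity_ge[OF assms]
  fix u
  let ?h = "\<lambda>k. (real k - real p powi (int n - int m))\<^sup>2"
  have spectrum: "(\<lambda>k. real (diff_spectrum F u k) * ?h k) sums (\<Sum>b\<in>UNIV. ?h (DDT F u b))"
    unfolding diff_spectrum_def by (rule sum_fibre_counts)
  show "summable (\<lambda>k. real (diff_spectrum F u k) * ?h k)"
    using spectrum by (rule sums_summable)
  show "(\<Sum>v\<in>UNIV - {0}. \<Sum>j\<in>prime_subfield.
        (real_of_int \<bar>centered_level_count p n m F u v j\<bar>)\<^sup>2)
      = (real p - 1) * real p ^ (m - 1) * (\<Sum>k. real (diff_spectrum F u k) * ?h k)"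
    unfolding sum_sq variance by (simp add: sums_unique[OF spectrum])
  show "Max ((\<lambda>u. (real p - 1) / ((real p)\<^sup>2 * (real p ^ m - 1))
          * (real p ^ m * real (collision_energy F u) - real p ^ (2 * n))) ` (UNIV - {0}))
      \<le> (real_of_int (full_profile_uniformity p n m F))\<^sup>2"
  proof (rule Max.boundedI)
    \<comment> \<open>The maximum must range over a nonempty set; 1 is a nonzero direction in any
      field.\<close>
    have "(1::'a) \<in> UNIV - {0}" by simp
    then show "(\<lambda>u. (real p - 1) / ((real p)\<^sup>2 * (real p ^ m - 1))
          * (real p ^ m * real (collision_energy F u) - real p ^ (2 * n))) ` (UNIV - {0}) \<noteq> {}"
      by blast
  qed (use bound in auto)
qed (fact sum_centered_level_count_squared[OF assms] energy_eq_variance[OF assms]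
    full_profile_uniformity_ge[OF assms])+

end
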